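(* Let $k_1,k_2,k_3\in\mathbb{Z}_{\ge0}$ and let $(P,Q,R)$ be a $(k_1,k_2,k_3)$-CGC triple associated with the non-labeled cluster $(a,b,c)$ such that $|b|>\max\{|a|,|c|\}$. Then there exists a unique Markov-monodromy decomposition $(X,Y,Z)$ of $(P,Q,R)$.
   Context: Fix $k_1,k_2,k_3\in\mathbb{Z}_{\ge0}$, indeterminates $x_1,x_2,x_3$. Mutations: $\mu_1(a,b,c)=(\frac{b^2+k_1bc+c^2}{a},b,c)$, $\mu_2(a,b,c)=(a,\frac{a^2+k_2ac+c^2}{b},c)$, $\mu_3(a,b,c)=(a,b,\frac{a^2+k_3ab+b^2}{c})$. Labeled clusters of $\mathcal{A}(k_1,k_2,k_3)$: triples obtained from $(x_1,x_2,x_3)$ by finitely many mutations; non-labeled clusters: permutations of labeled clusters; cluster variables: their entries; a cluster variable $y$ occurs in a unique position $i$ among labeled clusters, and its parity is $k_y:=k_i$. $|a|$ is the value of a Laurent polynomial $a$ at $x_1=x_2=x_3=1$. $\mathscr{M}=\frac{x_1^2+x_2^2+x_3^2+k_1x_2x_3+k_2x_1x_3+k_3x_1x_2}{x_1x_2x_3}$, $T=\begin{bmatrix}-1&0\\ \mathscr{M}&-1\end{bmatrix}$, and for a $2\times2$ matrix $P=(p_{ij})$, $S_P=\begin{bmatrix}\mathscr{M}p_{12}-\mathrm{tr}P&0\\(\mathscr{M}p_{12}-\mathrm{tr}P)\mathscr{M}&\mathscr{M}p_{12}-\mathrm{tr}P\end{bmatrix}$. A CGC matrix is $P\in SL(2,\mathbb{Z}[x_1^{\pm1},x_2^{\pm1},x_3^{\pm1}])$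 with $(1,2)$-entry $p_{12}$ a cluster variable and $\mathrm{tr}P=\mathscr{M}p_{12}-k_{p_{12}}$; a CGC triple is a triple $(P,Q,R)$ of CGC matrices with $Q=PR-S_Q$ and $(p_{12},q_{12},r_{12})$ a non-labeled cluster (associated cluster). A CMM matrix is $X\in SL(2,\mathbb{Z}[x_1^{\pm1},x_2^{\pm1},x_3^{\pm1}])$ with $(1,2)$-entry $x_{12}$ a cluster variable and $\mathrm{tr}X=-k_{x_{12}}$; a CMM triple is a triple $(X,Y,Z)$ of CMM matrices with $XYZ=T$ and $(x_{12},y_{12},z_{12})$ a non-labeled cluster. A Markov-monodromy decomposition of a CGC triple $(P,Q,R)$ associated with $(a,b,c)$ is a triple $(X,Y,Z)$ such that (1) $(X,Y,Z)$ is a CMM triple; (2) $P=-(YZ)^{-1}$, $Q=-(XZ)^{-1}$, $R=-(XY)^{-1}$; (3) $\mathrm{tr}X=-k_a$, $\mathrm{tr}Y=-k_b$, $\mathrm{tr}Z=-k_c$. *)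

theory Defs
  imports "HOL-Analysis.Analysis" "HOL-Computational_Algebra.Polynomial_Factorial"
begin

text \<open>
  The ambient field is the field of fractions of Z[x1][x2][x3], that is Q(x1,x2,x3), so that
  mutations can be written with the division of the field. Laurent polynomials with integer
  coefficients form a subset of it.
\<close>

type_synonym ratfun = "int poly poly poly fract"

definition indet1 :: ratfun where "indet1 = to_fract [:[:[:0, 1:]:]:]"
definition indet2 :: ratfun where "indet2 = to_fract [:[:0, 1:]:]"
definition indet3 :: ratfun where "indet3 = to_fract [:0, 1:]"

definition laurent_polys :: "ratfun set" where
  "laurent_polys =
     {to_fract p / (indet1 ^ i * indet2 ^ j * indet3 ^ l) | p i j l. True}"

text \<open>
  Value of a Laurent polynomial at x1 = x2 = x3 = 1. The innermost \<open>poly\<close> substitutes for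
  x3, the outermost one for x1. Independence of the chosen presentation is shown below.
\<close>

definition value_at_ones :: "ratfun \<Rightarrow> int" where
  "value_at_ones f = (THE v. \<exists>p i j l.
     f = to_fract p / (indet1 ^ i * indet2 ^ j * indet3 ^ l) \<and> v = poly (poly (poly p 1) 1) 1)"

lemma value_at_ones_eq:
  "value_at_ones (to_fract p / (indet1 ^ i * indet2 ^ j * indet3 ^ l)) = poly (poly (poly p 1) 1) 1"
proof -
  define m :: "nat \<Rightarrow> nat \<Rightarrow> nat \<Rightarrow> int poly poly poly" where
    "m i j l = [:[:[:0, 1:]:]:] ^ i * [:[:0, 1:]:] ^ j * [:0, 1:] ^ l" for i j l
  have m_fract: "indet1 ^ i * indet2 ^ j * indet3 ^ l = to_fract (m i j l)" for i j l
  proof -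
    have "to_fract (q ^ n) = to_fract q ^ n" for q :: "int poly poly poly" and n
      by (induction n) simp_all
    then show ?thesis
      by (simp add: m_def indet1_def indet2_def indet3_def)
  qed
  have m_nz: "m i j l \<noteq> 0" for i j l
    by (simp add: m_def)
  have m_val: "poly (poly (poly (m i j l) 1) 1) 1 = 1" for i j l
    by (simp add: m_def poly_mult poly_power)
  have "poly (poly (poly p 1) 1) 1 = poly (poly (poly p' 1) 1) 1"
    if "to_fract p / (indet1 ^ i * indet2 ^ j * indet3 ^ l) =
        to_fract p' / (indet1 ^ i' * indet2 ^ j' * indet3 ^ l')" for p' i' j' l'
  proof -
    from that have "to_fract (p * m i' j' l') = to_fract (p' * m i j l)"
      by (simp add: m_fract m_nz frac_eq_eq)
    then have "p * m i' j' l' = p' * m i j l"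
      by (simp only: to_fract_eq_iff)
    then have "poly (poly (poly (p * m i' j' l') 1) 1) 1 = poly (poly (poly (p' * m i j l) 1) 1) 1"
      by simp
    then show ?thesis
      by (simp add: m_val)
  qed
  then show ?thesis
    unfolding value_at_ones_def by (intro the_equality) metis+
qed

type_synonym triple = "ratfun \<times> ratfun \<times> ratfun"

fun mutation1 :: "nat \<Rightarrow> triple \<Rightarrow> triple" where
  "mutation1 k1 (a, b, c) = ((b\<^sup>2 + of_nat k1 * b * c + c\<^sup>2) / a, b, c)"

fun mutation2 :: "nat \<Rightarrow> triple \<Rightarrow> triple" where
  "mutation2 k2 (a, b, c) = (a, (a\<^sup>2 + of_nat k2 * a * c + c\<^sup>2) / b, c)"

fun mutation3 :: "nat \<Rightarrow> triple \<Rightarrow> triple" where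
  "mutation3 k3 (a, b, c) = (a, b, (a\<^sup>2 + of_nat k3 * a * b + b\<^sup>2) / c)"

inductive_set labeled_clusters :: "nat \<Rightarrow> nat \<Rightarrow> nat \<Rightarrow> triple set" for k1 k2 k3 where
  initial: "(indet1, indet2, indet3) \<in> labeled_clusters k1 k2 k3"
| mut1: "t \<in> labeled_clusters k1 k2 k3 \<Longrightarrow> mutation1 k1 t \<in> labeled_clusters k1 k2 k3"
| mut2: "t \<in> labeled_clusters k1 k2 k3 \<Longrightarrow> mutation2 k2 t \<in> labeled_clusters k1 k2 k3"
| mut3: "t \<in> labeled_clusters k1 k2 k3 \<Longrightarrow> mutation3 k3 t \<in> labeled_clusters k1 k2 k3"

definition nonlabeled_clusters :: "nat \<Rightarrow> nat \<Rightarrow> nat \<Rightarrow> triple set" where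
  "nonlabeled_clusters k1 k2 k3 = {(a, b, c). \<exists>y1 y2 y3.
     (y1, y2, y3) \<in> labeled_clusters k1 k2 k3 \<and> mset [a, b, c] = mset [y1, y2, y3]}"

definition occurs_at :: "nat \<Rightarrow> nat \<Rightarrow> nat \<Rightarrow> ratfun \<Rightarrow> nat \<Rightarrow> bool" where
  "occurs_at k1 k2 k3 y i \<longleftrightarrow> (\<exists>y1 y2 y3. (y1, y2, y3) \<in> labeled_clusters k1 k2 k3 \<and>
     (i = 1 \<and> y = y1 \<or> i = 2 \<and> y = y2 \<or> i = 3 \<and> y = y3))"

definition cluster_variables :: "nat \<Rightarrow> nat \<Rightarrow> nat \<Rightarrow> ratfun set" where
  "cluster_variables k1 k2 k3 = {y. \<exists>i. occurs_at k1 k2 k3 y i}"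

text \<open>
  Meaningful for cluster variables, each of which occurs in exactly one position: modulo 2 the
  denominator vector of the entry in position i of any labeled cluster is the i-th unit vector.
\<close>

definition parity :: "nat \<Rightarrow> nat \<Rightarrow> nat \<Rightarrow> ratfun \<Rightarrow> nat" where
  "parity k1 k2 k3 y =
     (let i = (THE i. occurs_at k1 k2 k3 y i) in if i = 1 then k1 else if i = 2 then k2 else k3)"

definition markov_elt :: "nat \<Rightarrow> nat \<Rightarrow> nat \<Rightarrow> ratfun" where
  "markov_elt k1 k2 k3 =
     (indet1\<^sup>2 + indet2\<^sup>2 + indet3\<^sup>2 + of_nat k1 * indet2 * indet3 + of_nat k2 * indet1 * indet3
        + of_nat k3 * indet1 * indet2) / (indet1 * indet2 * indet3)"

type_synonym mat2 = "ratfun^2^2"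

definition SL2_laurent :: "mat2 set" where
  "SL2_laurent = {A. (\<forall>i j. A $ i $ j \<in> laurent_polys) \<and> det A = 1}"

definition T_mat :: "nat \<Rightarrow> nat \<Rightarrow> nat \<Rightarrow> mat2" where
  "T_mat k1 k2 k3 = vector [vector [- 1, 0], vector [markov_elt k1 k2 k3, - 1]]"

definition S_mat :: "nat \<Rightarrow> nat \<Rightarrow> nat \<Rightarrow> mat2 \<Rightarrow> mat2" where
  "S_mat k1 k2 k3 P =
     (let M = markov_elt k1 k2 k3; s = M * P $ 1 $ 2 - trace P
      in vector [vector [s, 0], vector [s * M, s]])"

fun entry12 :: "mat2 \<times> mat2 \<times> mat2 \<Rightarrow> triple" where
  "entry12 (A, B, C) = (A $ 1 $ 2, B $ 1 $ 2, C $ 1 $ 2)"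

definition CGC_matrix :: "nat \<Rightarrow> nat \<Rightarrow> nat \<Rightarrow> mat2 \<Rightarrow> bool" where
  "CGC_matrix k1 k2 k3 P \<longleftrightarrow>
     P \<in> SL2_laurent \<and> P $ 1 $ 2 \<in> cluster_variables k1 k2 k3 \<and>
     trace P = markov_elt k1 k2 k3 * P $ 1 $ 2 - of_nat (parity k1 k2 k3 (P $ 1 $ 2))"

fun CGC_triple :: "nat \<Rightarrow> nat \<Rightarrow> nat \<Rightarrow> mat2 \<times> mat2 \<times> mat2 \<Rightarrow> bool" where
  "CGC_triple k1 k2 k3 (P, Q, R) \<longleftrightarrow>
     CGC_matrix k1 k2 k3 P \<and> CGC_matrix k1 k2 k3 Q \<and> CGC_matrix k1 k2 k3 R \<and>
     Q = P ** R - S_mat k1 k2 k3 Q \<and>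
     entry12 (P, Q, R) \<in> nonlabeled_clusters k1 k2 k3"

definition CMM_matrix :: "nat \<Rightarrow> nat \<Rightarrow> nat \<Rightarrow> mat2 \<Rightarrow> bool" where
  "CMM_matrix k1 k2 k3 X \<longleftrightarrow>
     X \<in> SL2_laurent \<and> X $ 1 $ 2 \<in> cluster_variables k1 k2 k3 \<and>
     trace X = - of_nat (parity k1 k2 k3 (X $ 1 $ 2))"

fun CMM_triple :: "nat \<Rightarrow> nat \<Rightarrow> nat \<Rightarrow> mat2 \<times> mat2 \<times> mat2 \<Rightarrow> bool" where
  "CMM_triple k1 k2 k3 (X, Y, Z) \<longleftrightarrow>
     CMM_matrix k1 k2 k3 X \<and> CMM_matrix k1 k2 k3 Y \<and> CMM_matrix k1 k2 k3 Z \<and>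
     X ** Y ** Z = T_mat k1 k2 k3 \<and>
     entry12 (X, Y, Z) \<in> nonlabeled_clusters k1 k2 k3"

text \<open>
  The parities in the trace conditions are those of the cluster (a, b, c) associated with
  (P, Q, R), not of the (1,2)-entries of X, Y, Z.
\<close>

fun markov_monodromy_decomposition ::
  "nat \<Rightarrow> nat \<Rightarrow> nat \<Rightarrow> mat2 \<times> mat2 \<times> mat2 \<Rightarrow> mat2 \<times> mat2 \<times> mat2 \<Rightarrow> bool" where
  "markov_monodromy_decomposition k1 k2 k3 (P, Q, R) (X, Y, Z) \<longleftrightarrow>
     CMM_triple k1 k2 k3 (X, Y, Z) \<and>
     P = - matrix_inv (Y ** Z) \<and> Q = - matrix_inv (X ** Z) \<and> R = - matrix_inv (X ** Y) \<and>
     (case entry12 (P, Q, R) of (a, b, c) \<Rightarrow>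
        trace X = - of_nat (parity k1 k2 k3 a) \<and>
        trace Y = - of_nat (parity k1 k2 k3 b) \<and>
        trace Z = - of_nat (parity k1 k2 k3 c))"

end

theory Submission
  imports Defs
begin

text \<open>
  The equations for \<open>P\<close>, \<open>R\<close> and \<open>XYZ = T\<close> force \<open>X = - TP\<close>, \<open>Z = - RT\<close> and
  \<open>Y = (RTP)\<^sup>-\<^sup>1\<close>. Conversely, for these matrices the equation for \<open>Q\<close> is the Cayley--Hamilton
  identity of \<open>TQ\<close>, and the (1,2)-entry of \<open>Y\<close> is
  \<open>M a c - k_c a - k_a c - b\<close>, which by the Markov equation of the cluster is the mutation of \<open>b\<close>.

  All this presupposes that the parity of a cluster variable is well defined. Order the monomials
  lexicographically. The leading coefficients involved are positive, so the leading exponent of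
  \<open>b\<^sup>2 + k b c + c\<^sup>2\<close> is twice the larger one of those of \<open>b\<close> and \<open>c\<close>. Hence mutations preserve
  leading exponents modulo 2, and those of the three initial variables are distinct.
\<close>

section \<open>Adjugates and inverses of matrices\<close>

definition adj2 :: "'a::comm_ring_1^2^2 \<Rightarrow> 'a^2^2" where
  "adj2 A = vector [vector [A $ 2 $ 2, - A $ 1 $ 2], vector [- A $ 2 $ 1, A $ 1 $ 1]]"

lemmas mat2_simps = vec_eq_iff forall_2 sum_2 matrix_matrix_mult_def det_2 trace_def mat_def

lemma adj2_mult: "A ** adj2 A = mat (det A)" "adj2 A ** A = mat (det A)"
  by (simp_all add: mat2_simps adj2_def algebra_simps)

lemma cayley_hamilton_2:
  fixes A :: "'a::comm_ring_1^2^2"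
  shows "A ** A + mat (det A) = mat (trace A) ** A"
  by (simp add: mat2_simps algebra_simps)

lemma matrix_inv_eqI:
  fixes A B :: "'a::field^'n^'n"
  assumes AB: "A ** B = mat 1"
  shows "matrix_inv A = B"
proof -
  have BA: "B ** A = mat 1"
    by (rule matrix_left_right_inverse[THEN iffD1, OF AB])
  have "A ** matrix_inv A = mat 1 \<and> matrix_inv A ** A = mat 1"
    unfolding matrix_inv_def by (rule someI[of _ B], rule conjI[OF AB BA])
  then have "B ** (A ** matrix_inv A) = B"
    by simp
  then show ?thesis
    unfolding matrix_mul_assoc BA by simp
qed

section \<open>Leading terms of exchange polynomials\<close>

lemma sum_of_squares_form_pos:
  fixes u v :: "'a::linordered_idom"
  assumes "u \<ge> 0" "v \<ge> 0" "u \<noteq> 0 \<or> v \<noteq> 0"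
  shows "u\<^sup>2 + of_nat k * u * v + v\<^sup>2 > 0"
proof -
  have "u\<^sup>2 + v\<^sup>2 > 0" "of_nat k * u * v \<ge> 0"
    using assms by (auto simp: sum_power2_gt_zero_iff)
  then have "(u\<^sup>2 + v\<^sup>2) + of_nat k * u * v > 0"
    by (rule add_pos_nonneg)
  then show ?thesis
    by (simp add: add_ac)
qed

text \<open>Only one term of the convolution survives the degree bounds. Bounds in place of exact
  degrees let \<open>p\<close> and \<open>q\<close> of different degree share one
  \<open>n\<close>.\<close>

lemma coeff_mult_add:
  assumes "degree p \<le> m" "degree q \<le> n"
  shows "coeff (p * q) (m + n) = coeff p m * coeff q n"
proof -
  have "coeff p i * coeff q (m + n - i) = (if i = m then coeff p m * coeff q n else 0)"
    if "i \<le> m + n" for i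
    using assms by (cases i m rule: linorder_cases) (auto simp: coeff_eq_0)
  then show ?thesis
    by (simp add: coeff_mult)
qed

text \<open>On iterated polynomials the order is thus decided by the lexicographically leading
  monomial, with the outermost variable (that of \<open>indet3\<close>) first.\<close>

lemma poly_pos_iff: "p > 0 \<longleftrightarrow> lead_coeff p > 0"
  by (simp add: less_poly_def pos_poly_def)

lemma poly_nonneg_coeff:
  fixes p :: "'a::linordered_idom poly"
  assumes "p \<ge> 0" "degree p \<le> n"
  shows "coeff p n \<ge> 0"
  using assms by (cases "degree p = n") (auto simp: coeff_eq_0 less_eq_poly_def pos_poly_def)

text \<open>At twice the larger degree \<open>n\<close>, the coefficient is the same form in the
  coefficients at \<open>n\<close>; it is positive, so nothing cancels. Having the same shape again
  allows a descent to the coefficient ring.\<close>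

lemma squares_form_lead:
  fixes p q :: "'a::linordered_idom poly"
  assumes "p \<ge> 0" "q \<ge> 0" "p \<noteq> 0 \<or> q \<noteq> 0"
  obtains u v n where "u \<ge> 0" "v \<ge> 0" "u \<noteq> 0 \<or> v \<noteq> 0"
    "lead_coeff (p\<^sup>2 + of_nat k * p * q + q\<^sup>2) = u\<^sup>2 + of_nat k * u * v + v\<^sup>2"
    "degree (p\<^sup>2 + of_nat k * p * q + q\<^sup>2) = 2 * n"
proof -
  define n where "n = max (degree p) (degree q)"
  define f where "f = p\<^sup>2 + of_nat k * p * q + q\<^sup>2"
  have le: "degree p \<le> n" "degree q \<le> n"
    by (auto simp: n_def)
  have nonneg: "coeff p n \<ge> 0" "coeff q n \<ge> 0"
    using assms le by (auto intro: poly_nonneg_coeff)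
  \<comment> \<open>The polynomial of larger degree supplies the nonzero coefficient; for equal
    degrees the third hypothesis does.\<close>
  have nz: "coeff p n \<noteq> 0 \<or> coeff q n \<noteq> 0"
    using assms(3) leading_coeff_0_iff[of p] leading_coeff_0_iff[of q]
    by (cases "degree p" "degree q" rule: linorder_cases) (auto simp: n_def)
  have c: "coeff f (2 * n) = (coeff p n)\<^sup>2 + of_nat k * coeff p n * coeff q n + (coeff q n)\<^sup>2"
    using le by (simp add: f_def power2_eq_square mult_2 coeff_mult_add of_nat_poly mult.assoc)
  have "degree f \<le> 2 * n"
    unfolding f_def power2_eq_square mult_2 of_nat_poly mult_pCons_left mult_smult_left
    using le by (intro degree_add_le)
      (auto intro!: order_trans[OF degree_mult_le] order_trans[OF degree_smult_le] add_mono)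
  moreover have "coeff f (2 * n) > 0"
    unfolding c using nonneg nz by (rule sum_of_squares_form_pos)
  ultimately have d: "degree f = 2 * n"
    using le_degree[of f "2 * n"] by (simp add: order_antisym)
  show ?thesis
    by (rule that[OF nonneg nz]) (use c d in \<open>simp_all add: f_def\<close>)
qed

text \<open>
  Signs such as \<open>(- 1) ^ degree p\<close> that are trivial on all \<open>p\<^sup>2 + k p q + q\<^sup>2\<close>, and therefore
  invariant under mutation.
\<close>

definition square_character :: "('a::linordered_idom \<Rightarrow> int) \<Rightarrow> bool" where
  "square_character \<sigma> \<longleftrightarrow>
     (\<forall>p q. p \<noteq> 0 \<longrightarrow> q \<noteq> 0 \<longrightarrow> \<sigma> (p * q) = \<sigma> p * \<sigma> q) \<and>
     (\<forall>p q k. p \<ge> 0 \<longrightarrow> q \<ge> 0 \<longrightarrow> p \<noteq> 0 \<or> q \<noteq> 0 \<longrightarrow> \<sigma> (p\<^sup>2 + of_nat k * p * q + q\<^sup>2) = 1)"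

lemma square_character_degree:
  "square_character (\<lambda>p :: 'a::linordered_idom poly. (- 1) ^ degree p)"
  unfolding square_character_def
proof (intro conjI allI impI)
  fix p q :: "'a poly" and k
  assume "p \<ge> 0" "q \<ge> 0" "p \<noteq> 0 \<or> q \<noteq> 0"
  then obtain n where "degree (p\<^sup>2 + of_nat k * p * q + q\<^sup>2) = 2 * n"
    by (rule squares_form_lead)
  then show "(- 1) ^ degree (p\<^sup>2 + of_nat k * p * q + q\<^sup>2) = (1::int)"
    by simp
qed (simp add: degree_mult_eq power_add)

text \<open>The leading coefficient of a form is a form over the coefficient ring, so a character
  there lifts and reads off the exponent of the next variable.\<close>

lemma square_character_lead_coeff:
  fixes \<sigma> :: "'a::linordered_idom \<Rightarrow> int"
  assumes "square_character \<sigma>"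
  shows "square_character (\<lambda>p. \<sigma> (lead_coeff p))"
  unfolding square_character_def
proof (intro conjI allI impI)
  fix p q :: "'a poly" and k
  assume "p \<ge> 0" "q \<ge> 0" "p \<noteq> 0 \<or> q \<noteq> 0"
  then obtain u v where uv: "u \<ge> 0" "v \<ge> 0" "u \<noteq> 0 \<or> v \<noteq> 0"
    "lead_coeff (p\<^sup>2 + of_nat k * p * q + q\<^sup>2) = u\<^sup>2 + of_nat k * u * v + v\<^sup>2"
    by (rule squares_form_lead)
  then show "\<sigma> (lead_coeff (p\<^sup>2 + of_nat k * p * q + q\<^sup>2)) = 1"
    unfolding uv(4) using assms by (simp add: square_character_def)
qed (use assms in \<open>simp add: square_character_def lead_coeff_mult\<close>)

lemma square_character_mult:
  "square_character \<sigma> \<Longrightarrow> p \<noteq> 0 \<Longrightarrow> q \<noteq> 0 \<Longrightarrow> \<sigma> (p * q) = \<sigma> p * \<sigma> q"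
  by (simp add: square_character_def)

lemma square_character_form:
  "square_character \<sigma> \<Longrightarrow> p > 0 \<Longrightarrow> q > 0 \<Longrightarrow> \<sigma> (p\<^sup>2 + of_nat k * p * q + q\<^sup>2) = 1"
  by (simp add: square_character_def)

lemma square_character_square:
  assumes "square_character \<sigma>" "p > 0"
  shows "\<sigma> p * \<sigma> p = 1"
proof -
  \<comment> \<open>With \<open>q = 0\<close> the form degenerates to
    \<open>p\<^sup>2\<close>.\<close>
  have "\<sigma> (p * p) = 1"
    using assms(1)[unfolded square_character_def, THEN conjunct2, rule_format, of p 0 0] assms(2)
    by (simp add: power2_eq_square)
  then show ?thesis
    using assms square_character_mult[of \<sigma> p p] by simp
qed

section \<open>Signs of fractions\<close>

lemma to_fract_of_nat: "to_fract (of_nat n) = of_nat n"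
  by (induction n) simp_all

text \<open>The product replaces a quotient because \<open>\<sigma> q\<close> is its own inverse.
  Positive representatives rule out cancellation in sums; \<open>has_sign_unique\<close> shows
  independence of the representative.\<close>

definition has_sign :: "('a::linordered_idom \<Rightarrow> int) \<Rightarrow> 'a fract \<Rightarrow> int \<Rightarrow> bool" where
  "has_sign \<sigma> f s \<longleftrightarrow>
     (\<exists>p q. p > 0 \<and> q > 0 \<and> f = to_fract p / to_fract q \<and> s = \<sigma> p * \<sigma> q)"

lemma has_sign_nonzero: "has_sign \<sigma> f s \<Longrightarrow> f \<noteq> 0"
  by (auto simp: has_sign_def)

lemma has_sign_to_fract:
  assumes "square_character \<sigma>" "p > 0"
  shows "has_sign \<sigma> (to_fract p) (\<sigma> p)"
proof -
  have "\<sigma> 1 = 1"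
    using square_character_square[OF assms(1), of 1] square_character_mult[OF assms(1), of 1 1]
    by simp
  then show ?thesis
    unfolding has_sign_def using assms by (intro exI[of _ p] exI[of _ 1]) auto
qed

lemma has_sign_divide:
  assumes \<sigma>: "square_character \<sigma>" and "has_sign \<sigma> f s" "has_sign \<sigma> g t"
  shows "has_sign \<sigma> (f / g) (s * t)"
proof -
  from assms obtain p q p' q' where *: "p > 0" "q > 0" "f = to_fract p / to_fract q" "s = \<sigma> p * \<sigma> q"
    "p' > 0" "q' > 0" "g = to_fract p' / to_fract q'" "t = \<sigma> p' * \<sigma> q'"
    unfolding has_sign_def by blast
  have "f / g = to_fract (p * q') / to_fract (q * p')" "s * t = \<sigma> (p * q') * \<sigma> (q * p')"
    using * square_character_mult[OF \<sigma>] by (auto simp: mult_ac)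
  moreover have "p * q' > 0" "q * p' > 0"
    using * by simp_all
  ultimately show ?thesis
    unfolding has_sign_def by blast
qed

text \<open>Over a common denominator \<open>r\<close> the numerator is a form in positive elements
  and the denominator a square, both of sign 1.\<close>

lemma has_sign_form:
  assumes \<sigma>: "square_character \<sigma>" and "has_sign \<sigma> f s" "has_sign \<sigma> g t"
  shows "has_sign \<sigma> (f\<^sup>2 + of_nat k * f * g + g\<^sup>2) 1"
proof -
  from assms obtain p q p' q' where *: "p > 0" "q > 0" "f = to_fract p / to_fract q"
    "p' > 0" "q' > 0" "g = to_fract p' / to_fract q'"
    unfolding has_sign_def by blast
  define u v r where "u = p * q'" and "v = p' * q" and "r = q * q'"
  have pos: "u > 0" "v > 0" "r > 0"
    using * by (simp_all add: u_def v_def r_def)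
  have "f = to_fract u / to_fract r" "g = to_fract v / to_fract r"
    using * by (simp_all add: u_def v_def r_def)
  then have "f\<^sup>2 + of_nat k * f * g + g\<^sup>2 =
      to_fract (u\<^sup>2 + of_nat k * u * v + v\<^sup>2) / to_fract (r * r)"
    by (simp add: to_fract_of_nat power2_eq_square add_divide_distrib mult_ac)
  moreover have "u\<^sup>2 + of_nat k * u * v + v\<^sup>2 > 0" "r * r > 0"
    using pos by (auto intro!: sum_of_squares_form_pos)
  moreover have "\<sigma> (u\<^sup>2 + of_nat k * u * v + v\<^sup>2) * \<sigma> (r * r) = 1"
    using pos square_character_form[OF \<sigma>] square_character_mult[OF \<sigma>, of r r]
      square_character_square[OF \<sigma>] by simp
  ultimately show ?thesis
    unfolding has_sign_def by metis
qed

lemma has_sign_unique: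
  assumes \<sigma>: "square_character \<sigma>" and "has_sign \<sigma> f s" "has_sign \<sigma> f t"
  shows "s = t"
proof -
  from assms obtain p q p' q' where *: "p > 0" "q > 0" "f = to_fract p / to_fract q" "s = \<sigma> p * \<sigma> q"
    "p' > 0" "q' > 0" "f = to_fract p' / to_fract q'" "t = \<sigma> p' * \<sigma> q'"
    unfolding has_sign_def by blast
  then have "to_fract (p * q') = to_fract (p' * q)"
    by (auto simp: frac_eq_eq)
  then have "\<sigma> p * \<sigma> q' = \<sigma> p' * \<sigma> q"
    using * square_character_mult[OF \<sigma>] by (metis less_irrefl to_fract_eq_iff)
  \<comment> \<open>Multiplying by \<open>\<sigma> q * \<sigma> q'\<close> creates squares, which
    drop out.\<close>
  then have "\<sigma> p * (\<sigma> q' * \<sigma> q') * \<sigma> q = \<sigma> p' * (\<sigma> q * \<sigma> q) * \<sigma> q'"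
    by (metis mult.assoc mult.commute)
  then show ?thesis
    using * square_character_square[OF \<sigma>] by simp
qed

text \<open>The numerator has sign 1, so the quotient inherits the sign of the entry it
  replaces.\<close>

lemma has_sign_mutation:
  assumes "square_character \<sigma>" "has_sign \<sigma> f r" "has_sign \<sigma> g s" "has_sign \<sigma> h t"
  shows "has_sign \<sigma> ((g\<^sup>2 + of_nat k * g * h + h\<^sup>2) / f) r"
  using has_sign_divide[OF assms(1) has_sign_form[OF assms(1,3,4)] assms(2)] by simp

section \<open>Positions and parities of cluster variables\<close>

fun has_signs :: "(int poly poly poly \<Rightarrow> int) \<Rightarrow> triple \<Rightarrow> int \<Rightarrow> int \<Rightarrow> int \<Rightarrow> bool" where
  "has_signs \<sigma> (a, b, c) r s t \<longleftrightarrow> has_sign \<sigma> a r \<and> has_sign \<sigma> b s \<and> has_sign \<sigma> c t"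

lemma labeled_cluster_signs:
  assumes \<sigma>: "square_character \<sigma>" and "t \<in> labeled_clusters k1 k2 k3"
  shows "has_signs \<sigma> t (\<sigma> [:[:[:0, 1:]:]:]) (\<sigma> [:[:0, 1:]:]) (\<sigma> [:0, 1:])"
  using assms(2)
proof induction
  case initial
  then show ?case
    using \<sigma> by (simp add: indet1_def indet2_def indet3_def has_sign_to_fract poly_pos_iff)
next
  case (mut1 t)
  obtain a b c where "t = (a, b, c)"
    by (cases t)
  then show ?case
    using mut1 \<sigma> by simp (blast intro: has_sign_mutation)
next
  case (mut2 t)
  obtain a b c where "t = (a, b, c)"
    by (cases t)
  then show ?case
    using mut2 \<sigma> by simp (blast intro: has_sign_mutation)
next
  case (mut3 t)
  obtain a b c where "t = (a, b, c)"
    by (cases t)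
  then show ?case
    using mut3 \<sigma> by simp (blast intro: has_sign_mutation)
qed

lemma occurs_at_sign:
  assumes \<sigma>: "square_character \<sigma>" and "occurs_at k1 k2 k3 y i"
  shows "has_sign \<sigma> y
    (if i = 1 then \<sigma> [:[:[:0, 1:]:]:] else if i = 2 then \<sigma> [:[:0, 1:]:] else \<sigma> [:0, 1:])"
  using assms(2) unfolding occurs_at_def by (auto dest!: labeled_cluster_signs[OF \<sigma>])

lemma occurs_at_unique:
  assumes "occurs_at k1 k2 k3 y i" "occurs_at k1 k2 k3 y j"
  shows "i = j"
proof -
  have ij: "i \<in> {1, 2, 3}" "j \<in> {1, 2, 3}"
    using assms by (auto simp: occurs_at_def)
  \<comment> \<open>These are the parities of the exponents of \<open>indet3\<close> and
    \<open>indet2\<close> in the leading monomial. On \<open>indet1\<close>, \<open>indet2\<close>,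
    \<open>indet3\<close> the pairs of values are (1, 1), (1, -1), (-1, 1).\<close>
  define \<sigma>1 \<sigma>2 :: "int poly poly poly \<Rightarrow> int"
    where "\<sigma>1 p = (- 1) ^ degree p" and "\<sigma>2 p = (- 1) ^ degree (lead_coeff p)" for p
  have 1: "square_character \<sigma>1"
    unfolding \<sigma>1_def by (rule square_character_degree)
  have 2: "square_character \<sigma>2"
    unfolding \<sigma>2_def by (rule square_character_lead_coeff[OF square_character_degree])
  show ?thesis
    using has_sign_unique[OF 1 occurs_at_sign[OF 1 assms(1)] occurs_at_sign[OF 1 assms(2)]]
      has_sign_unique[OF 2 occurs_at_sign[OF 2 assms(1)] occurs_at_sign[OF 2 assms(2)]] ij
    by (auto simp: \<sigma>1_def \<sigma>2_def)
qed

lemma parity_eq: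
  assumes "occurs_at k1 k2 k3 y i"
  shows "parity k1 k2 k3 y = (if i = 1 then k1 else if i = 2 then k2 else k3)"
proof -
  have "(THE i. occurs_at k1 k2 k3 y i) = i"
    using assms occurs_at_unique by blast
  then show ?thesis
    by (simp add: parity_def)
qed

lemma labeled_cluster_parity:
  assumes "(y1, y2, y3) \<in> labeled_clusters k1 k2 k3"
  shows "parity k1 k2 k3 y1 = k1" "parity k1 k2 k3 y2 = k2" "parity k1 k2 k3 y3 = k3"
proof -
  have "occurs_at k1 k2 k3 y1 1" "occurs_at k1 k2 k3 y2 2" "occurs_at k1 k2 k3 y3 3"
    using assms by (auto simp: occurs_at_def)
  then show "parity k1 k2 k3 y1 = k1" "parity k1 k2 k3 y2 = k2" "parity k1 k2 k3 y3 = k3"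
    by (simp_all add: parity_eq)
qed

text \<open>A by-product of positivity: a fraction with a sign has a positive numerator.\<close>

lemma labeled_cluster_nonzero:
  assumes "(y1, y2, y3) \<in> labeled_clusters k1 k2 k3"
  shows "y1 \<noteq> 0" "y2 \<noteq> 0" "y3 \<noteq> 0"
  using labeled_cluster_signs[OF square_character_degree assms] by (auto dest: has_sign_nonzero)

section \<open>The Markov equation\<close>

definition markov_rel :: "'a::field \<Rightarrow> 'a \<Rightarrow> 'a \<Rightarrow> 'a \<Rightarrow> 'a \<Rightarrow> 'a \<Rightarrow> 'a \<Rightarrow> bool" where
  "markov_rel M ka kb kc a b c \<longleftrightarrow>
     a\<^sup>2 + b\<^sup>2 + c\<^sup>2 + ka * b * c + kb * a * c + kc * a * b = M * a * b * c"

text \<open>Vieta jumping: the two roots of the Markov equation in \<open>a\<close> have product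
  \<open>b\<^sup>2 + ka b c + c\<^sup>2\<close>.\<close>

lemma markov_rel_mutation:
  assumes "markov_rel M ka kb kc a b c" "a \<noteq> 0"
  shows "markov_rel M ka kb kc ((b\<^sup>2 + ka * b * c + c\<^sup>2) / a) b c"
    and "a + (b\<^sup>2 + ka * b * c + c\<^sup>2) / a = M * b * c - kb * c - kc * b"
proof -
  define a' where "a' = (b\<^sup>2 + ka * b * c + c\<^sup>2) / a"
  have prod: "a * a' = b\<^sup>2 + ka * b * c + c\<^sup>2"
    using assms(2) by (simp add: a'_def)
  have "a * (a + a') = a * (M * b * c - kb * c - kc * b)"
    using assms(1) prod by (simp add: markov_rel_def power2_eq_square algebra_simps)
  then have sum: "a + a' = M * b * c - kb * c - kc * b"
    using assms(2) by simp
  then show "a + (b\<^sup>2 + ka * b * c + c\<^sup>2) / a = M * b * c - kb * c - kc * b"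
    by (simp add: a'_def)
  \<comment> \<open>The relations for the sum and the product are symmetric in \<open>a\<close> and
    \<open>a'\<close>, so they give back the equation for \<open>a'\<close>.\<close>
  have "a' * (a + a') = a' * (M * b * c - kb * c - kc * b)"
    by (simp add: sum)
  then have "markov_rel M ka kb kc a' b c"
    using prod by (simp add: markov_rel_def power2_eq_square algebra_simps)
  then show "markov_rel M ka kb kc ((b\<^sup>2 + ka * b * c + c\<^sup>2) / a) b c"
    by (simp add: a'_def)
qed

text \<open>Permuting the variables together with their parities reduces every mutation to the first
  position.\<close>

lemma markov_rel_swap:
  "markov_rel M ka kb kc a b c \<longleftrightarrow> markov_rel M kb ka kc b a c"
  "markov_rel M ka kb kc a b c \<longleftrightarrow> markov_rel M kc kb ka c b a"
  by (auto simp: markov_rel_def algebra_simps)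

fun markov_triple :: "nat \<Rightarrow> nat \<Rightarrow> nat \<Rightarrow> triple \<Rightarrow> bool" where
  "markov_triple k1 k2 k3 (a, b, c) \<longleftrightarrow>
     markov_rel (markov_elt k1 k2 k3) (of_nat k1) (of_nat k2) (of_nat k3) a b c"

lemma indet_nonzero: "indet1 \<noteq> 0" "indet2 \<noteq> 0" "indet3 \<noteq> 0"
  by (simp_all add: indet1_def indet2_def indet3_def)

text \<open>\<open>markov_elt\<close> is chosen so that the initial cluster satisfies the equation;
  Vieta jumping preserves it.\<close>

lemma labeled_cluster_markov:
  assumes "t \<in> labeled_clusters k1 k2 k3"
  shows "markov_triple k1 k2 k3 t"
  using assms
proof induction
  case initial
  then show ?case
    by (simp add: markov_rel_def markov_elt_def indet_nonzero mult.assoc)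
next
  case (mut1 t)
  obtain a b c where t: "t = (a, b, c)"
    by (cases t)
  then show ?case
    using mut1 markov_rel_mutation(1)[of _ _ _ _ a b c] labeled_cluster_nonzero[of a b c]
    by simp
next
  case (mut2 t)
  obtain a b c where t: "t = (a, b, c)"
    by (cases t)
  then show ?case
    using mut2 markov_rel_mutation(1)[of _ _ _ _ b a c] labeled_cluster_nonzero[of a b c]
    by (simp add: markov_rel_swap(1)[of _ _ _ _ a])
next
  case (mut3 t)
  obtain a b c where t: "t = (a, b, c)"
    by (cases t)
  \<comment> \<open>Exchanging the first and third positions reverses \<open>a\<close> and
    \<open>b\<close> in the exchange polynomial.\<close>
  have sym: "a\<^sup>2 + of_nat k3 * a * b + b\<^sup>2 = b\<^sup>2 + of_nat k3 * b * a + a\<^sup>2"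
    by (simp add: algebra_simps)
  show ?case
    using t mut3 markov_rel_mutation(1)[of _ _ _ _ c b a] labeled_cluster_nonzero[of a b c]
    by (simp add: markov_rel_swap(2)[of _ _ _ _ a] sym)
qed


section \<open>Mutating the middle entry of a non-labeled cluster\<close>

lemma nonlabeled_cluster_cases [consumes 1]:
  assumes "(a, b, c) \<in> nonlabeled_clusters k1 k2 k3"
  obtains "(a, b, c) \<in> labeled_clusters k1 k2 k3" | "(a, c, b) \<in> labeled_clusters k1 k2 k3"
  | "(b, a, c) \<in> labeled_clusters k1 k2 k3" | "(b, c, a) \<in> labeled_clusters k1 k2 k3"
  | "(c, a, b) \<in> labeled_clusters k1 k2 k3" | "(c, b, a) \<in> labeled_clusters k1 k2 k3"
  using assms unfolding nonlabeled_clusters_def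
  by (auto simp: add_eq_conv_ex)

text \<open>\<open>b\<close> has some position in a labeled cluster. Mutating there keeps the
  position, hence the parity, and the sum of the two Vieta roots gives the last claim.\<close>

lemma nonlabeled_clusters_mutation:
  assumes "(a, b, c) \<in> nonlabeled_clusters k1 k2 k3"
  defines "ka \<equiv> parity k1 k2 k3 a" and "kb \<equiv> parity k1 k2 k3 b" and "kc \<equiv> parity k1 k2 k3 c"
  defines "b' \<equiv> (a\<^sup>2 + of_nat kb * a * c + c\<^sup>2) / b"
  shows "(a, b', c) \<in> nonlabeled_clusters k1 k2 k3"
    and "b' \<in> cluster_variables k1 k2 k3"
    and "parity k1 k2 k3 b' = kb"
    and "b + b' = markov_elt k1 k2 k3 * a * c - of_nat kc * a - of_nat ka * c"
proof -
  define good where "good b' \<longleftrightarrow> (a, b', c) \<in> nonlabeled_clusters k1 k2 k3 \<and>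
    b' \<in> cluster_variables k1 k2 k3 \<and> parity k1 k2 k3 b' = kb \<and>
    b + b' = markov_elt k1 k2 k3 * a * c - of_nat kc * a - of_nat ka * c" for b'
  have goodI: "good b'"
    if "i \<in> {1, 2, 3}" "occurs_at k1 k2 k3 b i" "occurs_at k1 k2 k3 b' i"
      "(a, b', c) \<in> nonlabeled_clusters k1 k2 k3"
      "markov_rel (markov_elt k1 k2 k3) (of_nat kb) (of_nat ka) (of_nat kc) b a c" "b \<noteq> 0"
    for i
  proof -
    have "b' \<in> cluster_variables k1 k2 k3"
      using that by (auto simp: cluster_variables_def)
    moreover have "parity k1 k2 k3 b' = kb"
      using that by (simp add: parity_eq kb_def)
    moreover have "b + b' = markov_elt k1 k2 k3 * a * c - of_nat kc * a - of_nat ka * c"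
      using markov_rel_mutation(2)[OF that(5,6)] unfolding b'_def by (simp add: algebra_simps)
    ultimately show ?thesis
      using that(4) unfolding good_def by simp
  qed
  \<comment> \<open>\<open>i\<close> is the position of \<open>b\<close>. The other two entries
    matter only as a set, since the Markov equation is symmetric under swapping them along with
    their parities.\<close>
  have core: "good b'"
    if l: "(y1, y2, y3) \<in> labeled_clusters k1 k2 k3" "(z1, z2, z3) \<in> labeled_clusters k1 k2 k3"
      and i: "i = 1 \<and> y1 = b \<and> z1 = b' \<and> y2 = z2 \<and> y3 = z3 \<and> {y2, y3} = {a, c} \<or>
        i = 2 \<and> y2 = b \<and> z2 = b' \<and> y1 = z1 \<and> y3 = z3 \<and> {y1, y3} = {a, c} \<or>
        i = 3 \<and> y3 = b \<and> z3 = b' \<and> y1 = z1 \<and> y2 = z2 \<and> {y1, y2} = {a, c}"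
    for y1 y2 y3 z1 z2 z3 and i :: nat
  proof (rule goodI[of i])
    show "i \<in> {1, 2, 3}" "b \<noteq> 0"
      using i labeled_cluster_nonzero[OF l(1)] by auto
    show "occurs_at k1 k2 k3 b i" "occurs_at k1 k2 k3 b' i"
      using i l unfolding occurs_at_def by auto
    have "mset [a, b', c] = mset [z1, z2, z3]"
      using i by (auto simp: add_mset_commute doubleton_eq_iff)
    then show "(a, b', c) \<in> nonlabeled_clusters k1 k2 k3"
      unfolding nonlabeled_clusters_def using l(2) by blast
    show "markov_rel (markov_elt k1 k2 k3) (of_nat kb) (of_nat ka) (of_nat kc) b a c"
      using labeled_cluster_markov[OF l(1)] labeled_cluster_parity[OF l(1)] i
      by (auto simp: ka_def kb_def kc_def markov_rel_def algebra_simps doubleton_eq_iff)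
  qed
  have first: "good b'" if l: "(b, y, z) \<in> labeled_clusters k1 k2 k3" and yz: "{y, z} = {a, c}" for y z
  proof -
    have "y\<^sup>2 + of_nat kb * y * z + z\<^sup>2 = a\<^sup>2 + of_nat kb * a * c + c\<^sup>2"
      using yz by (auto simp: doubleton_eq_iff)
    then have "(b', y, z) \<in> labeled_clusters k1 k2 k3"
      using labeled_clusters.mut1[OF l] labeled_cluster_parity[OF l] by (simp add: b'_def kb_def)
    then show ?thesis
      using core[OF l, of b' y z 1] yz by simp
  qed
  have second: "good b'" if l: "(y, b, z) \<in> labeled_clusters k1 k2 k3" and yz: "{y, z} = {a, c}" for y z
  proof -
    have "y\<^sup>2 + of_nat kb * y * z + z\<^sup>2 = a\<^sup>2 + of_nat kb * a * c + c\<^sup>2"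
      using yz by (auto simp: doubleton_eq_iff)
    then have "(y, b', z) \<in> labeled_clusters k1 k2 k3"
      using labeled_clusters.mut2[OF l] labeled_cluster_parity[OF l] by (simp add: b'_def kb_def)
    then show ?thesis
      using core[OF l, of y b' z 2] yz by simp
  qed
  have third: "good b'" if l: "(y, z, b) \<in> labeled_clusters k1 k2 k3" and yz: "{y, z} = {a, c}" for y z
  proof -
    have "y\<^sup>2 + of_nat kb * y * z + z\<^sup>2 = a\<^sup>2 + of_nat kb * a * c + c\<^sup>2"
      using yz by (auto simp: doubleton_eq_iff)
    then have "(y, z, b') \<in> labeled_clusters k1 k2 k3"
      using labeled_clusters.mut3[OF l] labeled_cluster_parity[OF l] by (simp add: b'_def kb_def)
    then show ?thesis
      using core[OF l, of y z b' 3] yz by simp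
  qed
  have "good b'"
    using assms(1) by (cases rule: nonlabeled_cluster_cases) (auto intro: first second third)
  then show "(a, b', c) \<in> nonlabeled_clusters k1 k2 k3" "b' \<in> cluster_variables k1 k2 k3"
    "parity k1 k2 k3 b' = kb"
    "b + b' = markov_elt k1 k2 k3 * a * c - of_nat kc * a - of_nat ka * c"
    by (simp_all add: good_def)
qed

section \<open>Laurent polynomials and \<open>SL2_laurent\<close>\<close>

lemma laurent_polysI: "to_fract p / (indet1 ^ i * indet2 ^ j * indet3 ^ l) \<in> laurent_polys"
  unfolding laurent_polys_def by blast

lemma to_fract_laurent: "to_fract p \<in> laurent_polys"
  using laurent_polysI[of p 0 0 0] by simp

lemma to_fract_power: "to_fract (p ^ n) = to_fract p ^ n"
  by (induction n) simp_all

lemma laurent_mult: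
  assumes "f \<in> laurent_polys" "g \<in> laurent_polys"
  shows "f * g \<in> laurent_polys"
proof -
  from assms obtain p i j l p' i' j' l' where
    "f = to_fract p / (indet1 ^ i * indet2 ^ j * indet3 ^ l)"
    "g = to_fract p' / (indet1 ^ i' * indet2 ^ j' * indet3 ^ l')"
    unfolding laurent_polys_def by blast
  then have "f * g = to_fract (p * p') / (indet1 ^ (i + i') * indet2 ^ (j + j') * indet3 ^ (l + l'))"
    by (simp add: power_add mult_ac)
  then show ?thesis
    by (metis laurent_polysI)
qed

lemma laurent_add:
  assumes "f \<in> laurent_polys" "g \<in> laurent_polys"
  shows "f + g \<in> laurent_polys"
proof -
  \<comment> \<open>Denominators are kept as polynomials so that the cross-multiplied numerator is
    one as well.\<close>
  define m :: "nat \<Rightarrow> nat \<Rightarrow> nat \<Rightarrow> int poly poly poly" where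
    "m i j l = [:[:[:0, 1:]:]:] ^ i * [:[:0, 1:]:] ^ j * [:0, 1:] ^ l" for i j l
  have m: "to_fract (m i j l) = indet1 ^ i * indet2 ^ j * indet3 ^ l" for i j l
    by (simp add: m_def to_fract_power indet1_def indet2_def indet3_def)
  have nz: "to_fract (m i j l) \<noteq> 0" for i j l
    by (simp add: m indet_nonzero)
  from assms obtain p i j l p' i' j' l' where
    "f = to_fract p / to_fract (m i j l)" "g = to_fract p' / to_fract (m i' j' l')"
    unfolding laurent_polys_def m by blast
  then have "f + g = to_fract (p * m i' j' l' + p' * m i j l) / (to_fract (m i j l) * to_fract (m i' j' l'))"
    using nz by (simp add: add_frac_eq mult_ac del: to_fract_eq_0_iff)
  also have "to_fract (m i j l) * to_fract (m i' j' l') =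
      indet1 ^ (i + i') * indet2 ^ (j + j') * indet3 ^ (l + l')"
    by (simp add: m power_add mult_ac)
  finally show ?thesis
    by (metis laurent_polysI)
qed

lemma laurent_uminus:
  assumes "f \<in> laurent_polys"
  shows "- f \<in> laurent_polys"
  using laurent_mult[OF to_fract_laurent[of "- 1"] assms] by simp

lemma markov_elt_laurent: "markov_elt k1 k2 k3 \<in> laurent_polys"
proof -
  let ?x1 = "[:[:[:0, 1:]:]:] :: int poly poly poly" and ?x2 = "[:[:0, 1:]:] :: int poly poly poly"
    and ?x3 = "[:0, 1:] :: int poly poly poly"
  have "markov_elt k1 k2 k3 = to_fract (?x1\<^sup>2 + ?x2\<^sup>2 + ?x3\<^sup>2 + of_nat k1 * ?x2 * ?x3
      + of_nat k2 * ?x1 * ?x3 + of_nat k3 * ?x1 * ?x2) / (indet1 ^ 1 * indet2 ^ 1 * indet3 ^ 1)"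
    unfolding markov_elt_def indet1_def indet2_def indet3_def
    by (simp only: to_fract_add to_fract_mult to_fract_power to_fract_of_nat power_one_right)
  then show ?thesis
    by (metis laurent_polysI)
qed

lemma SL2_laurent_mult:
  assumes "A \<in> SL2_laurent" "B \<in> SL2_laurent"
  shows "A ** B \<in> SL2_laurent"
proof -
  have "(A ** B) $ i $ j \<in> laurent_polys" for i j
    using assms by (auto simp: SL2_laurent_def matrix_matrix_mult_def sum_2
        intro!: laurent_add laurent_mult)
  then show ?thesis
    using assms by (simp add: SL2_laurent_def det_mul)
qed

lemma SL2_laurent_uminus:
  assumes "A \<in> SL2_laurent"
  shows "- A \<in> SL2_laurent"
  using assms by (auto simp: SL2_laurent_def det_2 intro: laurent_uminus)

lemma SL2_inverse:
  fixes A :: "'a::field^2^2"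
  assumes "det A = 1"
  shows "matrix_inv A = adj2 A"
  using adj2_mult(1)[of A] by (intro matrix_inv_eqI) (simp add: assms)

text \<open>The adjugate involves no division, so inverses of determinant 1 matrices keep Laurent
  entries.\<close>

lemma SL2_laurent_adj2:
  assumes "A \<in> SL2_laurent"
  shows "adj2 A \<in> SL2_laurent"
  using assms by (auto simp: SL2_laurent_def adj2_def det_2 forall_2 mult.commute intro: laurent_uminus)

section \<open>Calculations with \<open>T_mat\<close> and traces\<close>

lemma T_mat_entries:
  "T_mat k1 k2 k3 $ 1 $ 1 = - 1" "T_mat k1 k2 k3 $ 1 $ 2 = 0"
  "T_mat k1 k2 k3 $ 2 $ 1 = markov_elt k1 k2 k3" "T_mat k1 k2 k3 $ 2 $ 2 = - 1"
  by (simp_all add: T_mat_def)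

lemma T_mat_SL2_laurent: "T_mat k1 k2 k3 \<in> SL2_laurent"
proof -
  have "- 1 \<in> laurent_polys" "0 \<in> laurent_polys"
    using to_fract_laurent[of "- 1"] to_fract_laurent[of 0] by simp_all
  then show ?thesis
    by (simp add: SL2_laurent_def forall_2 det_2 T_mat_entries markov_elt_laurent)
qed

lemma matrix_mult_minus:
  fixes A B :: "'a::ring_1^'n^'n"
  shows "(- A) ** B = - (A ** B)" "A ** (- B) = - (A ** B)"
  by (simp_all add: vec_eq_iff matrix_matrix_mult_def sum_negf)

lemma matrix_diff_mult:
  fixes A B C :: "'a::ring_1^'n^'n"
  shows "(A - B) ** C = A ** C - B ** C"
  by (simp add: vec_eq_iff matrix_matrix_mult_def left_diff_distrib sum_subtractf)

text \<open>This turns the trace condition of a CGC matrix \<open>A\<close> into: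
  \<open>T_mat k1 k2 k3 ** A\<close> has the parity as its trace.\<close>

lemma trace_T_mult: "trace (T_mat k1 k2 k3 ** A) = markov_elt k1 k2 k3 * A $ 1 $ 2 - trace A"
  by (simp add: trace_def sum_2 matrix_matrix_mult_def T_mat_entries)

text \<open>\<open>S_mat\<close> is minus a scalar multiple of the inverse of
  \<open>T_mat\<close>.\<close>

lemma T_mult_S_mat:
  "T_mat k1 k2 k3 ** S_mat k1 k2 k3 A = - mat (markov_elt k1 k2 k3 * A $ 1 $ 2 - trace A)"
  by (simp add: vec_eq_iff forall_2 sum_2 matrix_matrix_mult_def mat_def T_mat_entries S_mat_def Let_def)

lemma trace_uminus: "trace (- A) = - trace (A :: 'a::ring_1^'n^'n)"
  by (simp add: trace_def sum_negf)

lemma trace_adj2: "trace (adj2 A) = trace A"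
  by (simp add: trace_def sum_2 adj2_def add.commute)

text \<open>The left side expands to \<open>trace R * P $ 1 $ 2 + trace P * R $ 1 $ 2 - M * P $ 1 $
  2 * R $ 1 $ 2\<close>; the trace conditions do the rest.\<close>

lemma CGC_middle_entry:
  assumes "trace P = M * P $ 1 $ 2 - ka" "trace R = M * R $ 1 $ 2 - kc"
    and "T $ 1 $ 1 = - 1" "T $ 1 $ 2 = 0" "T $ 2 $ 1 = M" "T $ 2 $ 2 = (- 1 :: 'a::comm_ring_1)"
  shows "adj2 (R ** (T ** P)) $ 1 $ 2 + (P ** R) $ 1 $ 2 = M * P $ 1 $ 2 * R $ 1 $ 2 - kc * P $ 1 $ 2 - ka * R $ 1 $ 2"
proof -
  have eqs: "P $ 2 $ 2 = M * P $ 1 $ 2 - ka - P $ 1 $ 1" "R $ 1 $ 1 = M * R $ 1 $ 2 - kc - R $ 2 $ 2"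
    using assms(1,2) by (simp_all add: trace_def sum_2 algebra_simps)
  show ?thesis
    by (simp add: adj2_def matrix_matrix_mult_def sum_2 assms(3-6) eqs algebra_simps)
qed

section \<open>Existence and uniqueness of the decomposition\<close>

theorem theorem6p13:
  fixes k1 k2 k3 :: nat and P Q R :: mat2 and a b c :: ratfun
  assumes "CGC_triple k1 k2 k3 (P, Q, R)"
    and "entry12 (P, Q, R) = (a, b, c)"
    and "value_at_ones b > max (value_at_ones a) (value_at_ones c)"
  shows "\<exists>!(X, Y, Z). markov_monodromy_decomposition k1 k2 k3 (P, Q, R) (X, Y, Z)"
proof -
  define M T where "M = markov_elt k1 k2 k3" and "T = T_mat k1 k2 k3"
  define ka kb kc where "ka = parity k1 k2 k3 a" and "kb = parity k1 k2 k3 b" and "kc = parity k1 k2 k3 c"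
  define X Y Z where "X = - (T ** P)" and "Y = adj2 (R ** (T ** P))" and "Z = - (R ** T)"
  have entries: "P $ 1 $ 2 = a" "Q $ 1 $ 2 = b" "R $ 1 $ 2 = c"
    using assms(2) by simp_all
  have SL: "P \<in> SL2_laurent" "Q \<in> SL2_laurent" "R \<in> SL2_laurent" "T \<in> SL2_laurent"
    using assms(1) T_mat_SL2_laurent by (auto simp: CGC_matrix_def T_def)
  then have det: "det P = 1" "det Q = 1" "det R = 1" "det T = 1"
    by (auto simp: SL2_laurent_def)
  have tr: "trace P = M * a - of_nat ka" "trace Q = M * b - of_nat kb" "trace R = M * c - of_nat kc"
    and PR: "P ** R = Q + S_mat k1 k2 k3 Q"
    and cluster: "(a, b, c) \<in> nonlabeled_clusters k1 k2 k3"
    and var: "a \<in> cluster_variables k1 k2 k3" "c \<in> cluster_variables k1 k2 k3"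
    using assms(1) entries by (auto simp: CGC_matrix_def M_def ka_def kb_def kc_def algebra_simps)
  have trT: "trace (T ** A) = M * A $ 1 $ 2 - trace A" for A
    by (simp add: T_def M_def trace_T_mult)
  have trW: "trace (T ** Q) = of_nat kb"
    by (simp add: trT entries tr)
  \<comment> \<open>Multiplication by \<open>T\<close> makes the correction term
    \<open>S_mat\<close> scalar, with scalar \<open>trace (T ** Q)\<close>.\<close>
  have TPR: "T ** P ** R = T ** Q - mat (of_nat kb)"
    unfolding matrix_mul_assoc[symmetric] PR matrix_add_ldistrib
    by (simp add: T_def T_mult_S_mat entries tr M_def)

  have "Y $ 1 $ 2 + b = M * a * c - of_nat kc * a - of_nat ka * c"
  proof -
    \<comment> \<open>\<open>S_mat\<close> is lower triangular and leaves this entry alone.\<close>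
    have "(P ** R) $ 1 $ 2 = b"
      by (simp add: PR S_mat_def Let_def entries)
    then show ?thesis
      using CGC_middle_entry[of P M "of_nat ka" R "of_nat kc" T] tr entries
      by (simp add: Y_def T_def T_mat_entries M_def)
  qed
  \<comment> \<open>Both \<open>Y $ 1 $ 2\<close> and the mutation of \<open>b\<close> complete
    \<open>b\<close> to the same sum.\<close>
  then have Y12: "Y $ 1 $ 2 = (a\<^sup>2 + of_nat kb * a * c + c\<^sup>2) / b"
    using nonlabeled_clusters_mutation(4)[OF cluster]
    by (simp add: ka_def kb_def kc_def M_def algebra_simps)
  have X12: "X $ 1 $ 2 = a" and Z12: "Z $ 1 $ 2 = c"
    by (simp_all add: X_def Z_def matrix_matrix_mult_def sum_2 T_def T_mat_entries entries)

  have trX: "trace X = - of_nat ka"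
    by (simp add: X_def trace_uminus trT entries tr)
  have trZ: "trace Z = - of_nat kc"
    by (simp add: Z_def trace_uminus trace_mul_sym[of R T] trT entries tr)
  have trY: "trace Y = - of_nat kb"
  proof -
    have "trace Y = trace (T ** P ** R)"
      unfolding Y_def trace_adj2 by (rule trace_mul_sym)
    \<comment> \<open>The scalar matrix has trace \<open>2 * kb\<close>, leaving
      \<open>kb - 2 * kb\<close>.\<close>
    also have "\<dots> = - of_nat kb"
      unfolding TPR trace_sub trW by (simp add: trace_def sum_2 mat_def)
    finally show ?thesis .
  qed
  have SL': "X \<in> SL2_laurent" "Y \<in> SL2_laurent" "Z \<in> SL2_laurent"
    using SL by (simp_all add: X_def Y_def Z_def SL2_laurent_mult SL2_laurent_uminus SL2_laurent_adj2)

  have YRTP: "Y ** (R ** (T ** P)) = mat 1" and RTPY: "R ** (T ** P) ** Y = mat 1"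
    unfolding Y_def adj2_mult by (simp_all add: det_mul det)
  \<comment> \<open>The right inverse \<open>T ** P ** Y\<close> of \<open>R\<close> is also a left
    inverse, which moves \<open>R\<close> to the end.\<close>
  then have TPYR: "T ** P ** Y ** R = mat 1"
    using matrix_left_right_inverse[of R "T ** P ** Y"] by (simp add: matrix_mul_assoc)
  have XYZ: "X ** Y ** Z = T"
    unfolding X_def Z_def matrix_mult_minus minus_minus matrix_mul_assoc TPYR by simp
  have "Y ** Z ** (- P) = mat 1"
    using YRTP unfolding Z_def matrix_mult_minus minus_minus by (simp add: matrix_mul_assoc)
  then have P: "P = - matrix_inv (Y ** Z)"
    by (simp add: matrix_inv_eqI)
  have "X ** Y ** (- R) = mat 1"
    using TPYR unfolding X_def matrix_mult_minus minus_minus .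
  then have R: "R = - matrix_inv (X ** Y)"
    by (simp add: matrix_inv_eqI)
  have "X ** Z ** (- Q) = - ((T ** P ** R) ** (T ** Q))"
    unfolding X_def Z_def matrix_mult_minus minus_minus by (simp add: matrix_mul_assoc)
  also have "\<dots> = mat (of_nat kb) ** (T ** Q) - (T ** Q) ** (T ** Q)"
    unfolding TPR matrix_diff_mult by simp
  \<comment> \<open>Cayley-Hamilton for \<open>T ** Q\<close>, of trace \<open>kb\<close> and
    determinant 1.\<close>
  also have "\<dots> = mat 1"
    using cayley_hamilton_2[of "T ** Q"] unfolding trW det_mul det by (metis add_diff_cancel_left' mult_1)
  finally have Q: "Q = - matrix_inv (X ** Z)"
    by (simp add: matrix_inv_eqI)

  \<comment> \<open>As mutation keeps the parity of \<open>b\<close>, the CMM trace conditions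
    coincide with those for \<open>a\<close>, \<open>b\<close>, \<open>c\<close>.\<close>
  have "markov_monodromy_decomposition k1 k2 k3 (P, Q, R) (X, Y, Z)"
    using nonlabeled_clusters_mutation(1-3)[OF cluster] var SL' trX trY trZ XYZ P Q R
    unfolding markov_monodromy_decomposition.simps CMM_triple.simps CMM_matrix_def entry12.simps
      X12 Y12 Z12 entries prod.case
    by (simp only: T_def ka_def kb_def kc_def simp_thms)
  moreover have "(X', Y', Z') = (X, Y, Z)"
    if "markov_monodromy_decomposition k1 k2 k3 (P, Q, R) (X', Y', Z')" for X' Y' Z'
  proof -
    have det': "det X' = 1" "det Y' = 1" "det Z' = 1" and T: "X' ** Y' ** Z' = T"
      and PR': "- P = adj2 (Y' ** Z')" "- R = adj2 (X' ** Y')"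
      using that by (auto simp: CMM_matrix_def SL2_laurent_def T_def SL2_inverse det_mul)
    have "Y' ** Z' ** (- P) = mat 1" "(- R) ** (X' ** Y') = mat 1"
      unfolding PR' adj2_mult by (simp_all add: det_mul det')
    then have "X' ** (Y' ** Z' ** (- P)) = X'" "(- R) ** (X' ** Y') ** Z' = Z'"
      by simp_all
    \<comment> \<open>Reassociated, the same products contain \<open>X' ** Y' ** Z' = T\<close>;
      comparison determines the outer factors.\<close>
    moreover have "X' ** (Y' ** Z' ** (- P)) = T ** (- P)" "(- R) ** (X' ** Y') ** Z' = (- R) ** T"
      unfolding T[symmetric] by (simp_all only: matrix_mul_assoc)
    ultimately have XZ': "X' = X" "Z' = Z"
      unfolding X_def Z_def by (simp_all add: matrix_mult_minus)
    \<comment> \<open>With \<open>X\<close> and \<open>Z\<close> known and invertible, the product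
      \<open>T\<close> determines the middle factor.\<close>
    have cancel: "adj2 X ** (X ** A ** Z) ** adj2 Z = A" for A
    proof -
      have "adj2 X ** (X ** A ** Z) ** adj2 Z = (adj2 X ** X) ** A ** (Z ** adj2 Z)"
        by (simp add: matrix_mul_assoc)
      then show ?thesis
        using det' unfolding XZ' adj2_mult by simp
    qed
    have "Y' = Y"
      using cancel[of Y] cancel[of Y'] T XYZ unfolding XZ' by simp
    then show ?thesis
      using XZ' by simp
  qed
  ultimately show ?thesis
    by (intro ex1I[of _ "(X, Y, Z)"]) auto
qed

end
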